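(* If $G$ is a linear $k$-tree (for a positive integer $k$), then $h(G)-1 = M(G) = Z(G) = k$, where $M(G)$ is taken over the real numbers.
   Context: For an integer $k\ge1$, a $k$-tree is a graph constructed by starting with a $(k+1)$-clique and repeating (zero or more times) the step: choose $k$ vertices inducing a clique and add a new vertex adjacent to exactly those $k$ vertices. A linear $k$-tree is a $k$-tree that either is a $(k+1)$-clique or has exactly two vertices of degree $k$. $h(G)$ is the Hadwiger number: the largest $t$ such that $G$ has $K_t$ as a minor. $M(G)$ is the maximum nullity of a real symmetric matrix whose off-diagonal $(i,j)$ entry is nonzero iff $\{i,j\}\in E(G)$ (diagonal arbitrary). $Z(G)$ is the zero forcing number: smallest size of an initially filled set from which repeatedly applying "a filled vertex whose only unfilled neighbor is $u$ forces $u$ to become filled" fills all vertices. *)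

theory Defs
  imports "Graph_Theory.Kuratowski" "Jordan_Normal_Form.Matrix_Kernel"
begin

text \<open>
  A finite simple graph is a \<^typ>\<open>'a pair_pre_digraph\<close> satisfying \<^locale>\<open>pair_graph\<close>:
  the undirected edge between \<open>u\<close> and \<open>v\<close> is the pair of opposite arcs
  \<open>(u, v)\<close> and \<open>(v, u)\<close>, and the degree of a vertex is its \<^const>\<open>out_degree\<close>.
\<close>

inductive k_tree :: "nat \<Rightarrow> 'a pair_pre_digraph \<Rightarrow> bool" for k :: nat where
  clique: "K\<^bsub>k + 1\<^esub> (with_proj G) \<Longrightarrow> k_tree k G"
| add_vertex: "\<lbrakk>k_tree k G; Q \<subseteq> pverts G; K\<^bsub>k\<^esub> (with_proj G \<restriction> Q); v \<notin> pverts G\<rbrakk> \<Longrightarrow>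
    k_tree k \<lparr>pverts = insert v (pverts G), parcs = parcs G \<union> {v} \<times> Q \<union> Q \<times> {v}\<rparr>"

definition linear_k_tree :: "nat \<Rightarrow> 'a pair_pre_digraph \<Rightarrow> bool" where
  "linear_k_tree k G \<longleftrightarrow> k_tree k G \<and>
     (K\<^bsub>k + 1\<^esub> (with_proj G) \<or>
      card {v \<in> pverts G. out_degree (with_proj G) v = k} = 2)"

definition delete_edge :: "'a pair_pre_digraph \<Rightarrow> 'a \<Rightarrow> 'a \<Rightarrow> 'a pair_pre_digraph" where
  "delete_edge G u v = \<lparr>pverts = pverts G, parcs = parcs G - {(u, v), (v, u)}\<rparr>"

definition delete_vertex :: "'a pair_pre_digraph \<Rightarrow> 'a \<Rightarrow> 'a pair_pre_digraph" where
  "delete_vertex G v = \<lparr>pverts = pverts G - {v},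
     parcs = {(x, y) \<in> parcs G. x \<noteq> v \<and> y \<noteq> v}\<rparr>"

text \<open>
  Contraction merges \<open>v\<close> into \<open>u\<close>, reusing \<open>u\<close> as the name of the new vertex.
  The resulting loops are discarded; parallel edges are identified because arcs form a set.
\<close>

definition contract_edge :: "'a pair_pre_digraph \<Rightarrow> 'a \<Rightarrow> 'a \<Rightarrow> 'a pair_pre_digraph" where
  "contract_edge G u v = (let f = (\<lambda>x. if x = v then u else x) in
     \<lparr>pverts = pverts G - {v},
      parcs = {(f x, f y) | x y. (x, y) \<in> parcs G \<and> f x \<noteq> f y}\<rparr>)"

inductive graph_minor :: "'a pair_pre_digraph \<Rightarrow> 'a pair_pre_digraph \<Rightarrow> bool"
  for G :: "'a pair_pre_digraph" where
  refl: "graph_minor G G"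
| delete_edge: "\<lbrakk>graph_minor G H; (u, v) \<in> parcs H\<rbrakk> \<Longrightarrow> graph_minor G (delete_edge H u v)"
| delete_vertex: "\<lbrakk>graph_minor G H; v \<in> pverts H\<rbrakk> \<Longrightarrow> graph_minor G (delete_vertex H v)"
| contract_edge: "\<lbrakk>graph_minor G H; (u, v) \<in> parcs H\<rbrakk> \<Longrightarrow> graph_minor G (contract_edge H u v)"

text \<open>\<open>graph_minor G H\<close> says that \<open>H\<close> is a minor of \<open>G\<close>.\<close>

definition hadwiger_number :: "'a pair_pre_digraph \<Rightarrow> nat" where
  "hadwiger_number G = Max {t. \<exists>H. graph_minor G H \<and> K\<^bsub>t\<^esub> (with_proj H)}"

text \<open>
  Rows and columns of a \<^typ>\<open>real mat\<close> are indexed by numbers, so the vertices are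
  identified with the indices by an arbitrary enumeration \<open>f\<close>.
\<close>

definition graph_matrices :: "'a pair_pre_digraph \<Rightarrow> real mat set" where
  "graph_matrices G = {A. A \<in> carrier_mat (card (pverts G)) (card (pverts G)) \<and> A\<^sup>T = A \<and>
     (\<exists>f. bij_betw f {..<card (pverts G)} (pverts G) \<and>
        (\<forall>i<card (pverts G). \<forall>j<card (pverts G).
           i \<noteq> j \<longrightarrow> (A $$ (i, j) \<noteq> 0 \<longleftrightarrow> (f i, f j) \<in> parcs G)))}"

definition max_nullity :: "'a pair_pre_digraph \<Rightarrow> nat" where
  "max_nullity G = Max (kernel_dim ` graph_matrices G)"

text \<open>In \<open>forces G B B'\<close>, the set \<open>B\<close> of filled vertices becomes \<open>B'\<close> by a single force.\<close>

definition forces :: "'a pair_pre_digraph \<Rightarrow> 'a set \<Rightarrow> 'a set \<Rightarrow> bool" where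
  "forces G B B' \<longleftrightarrow> (\<exists>v\<in>B. \<exists>u. {w. (v, w) \<in> parcs G} - B = {u} \<and> B' = insert u B)"

definition zero_forcing_set :: "'a pair_pre_digraph \<Rightarrow> 'a set \<Rightarrow> bool" where
  "zero_forcing_set G B \<longleftrightarrow> B \<subseteq> pverts G \<and> (forces G)\<^sup>*\<^sup>* B (pverts G)"

definition zero_forcing_number :: "'a pair_pre_digraph \<Rightarrow> nat" where
  "zero_forcing_number G = Min (card ` {B. zero_forcing_set G B})"

lemma pair_graph_iff:
  "pair_graph G \<longleftrightarrow> finite (pverts G) \<and> parcs G \<subseteq> pverts G \<times> pverts G \<and> sym (parcs G) \<and>
     (\<forall>x. (x, x) \<notin> parcs G)"
proof
  assume "pair_graph G"
  then interpret pair_graph G .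
  have "sym (parcs G)"
    using pair_sym_arcs by (simp add: symmetric_def)
  moreover have "(x, x) \<notin> parcs G" for x
    using pair_no_loops[of "(x, x)"] by auto
  ultimately show "finite (pverts G) \<and> parcs G \<subseteq> pverts G \<times> pverts G \<and> sym (parcs G) \<and>
     (\<forall>x. (x, x) \<notin> parcs G)"
    using pair_finite_verts in_arcsD1 in_arcsD2 by auto
next
  assume *: "finite (pverts G) \<and> parcs G \<subseteq> pverts G \<times> pverts G \<and> sym (parcs G) \<and>
     (\<forall>x. (x, x) \<notin> parcs G)"
  then have "finite (parcs G)"
    by (meson finite_SigmaI finite_subset)
  with * show "pair_graph G"
    by unfold_locales (auto simp: symmetric_def)
qed

lemma k_tree_pair_graph: "k_tree k G \<Longrightarrow> pair_graph G"
proof (induction rule: k_tree.induct)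
  case (clique G)
  then show ?case
    by (auto simp: complete_digraph_pair_def pair_graph_iff sym_def)
next
  case (add_vertex G Q v)
  then show ?case
    unfolding pair_graph_iff by (auto simp: sym_def)
qed

lemma graph_minor_pair_graph:
  assumes "graph_minor G H" "pair_graph G"
  shows "pair_graph H \<and> pverts H \<subseteq> pverts G"
  using assms
proof (induction rule: graph_minor.induct)
  case (contract_edge H u v)
  then have H: "pair_graph H" "pverts H \<subseteq> pverts G" by auto
  have "sym (parcs (contract_edge H u v))"
  proof (rule symI)
    fix a b assume "(a, b) \<in> parcs (contract_edge H u v)"
    then obtain x y where xy: "(x, y) \<in> parcs H" "a = (if x = v then u else x)"
      "b = (if y = v then u else y)" "a \<noteq> b"
      by (auto simp: contract_edge_def Let_def)
    moreover have "(y, x) \<in> parcs H"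
      using H xy(1) by (auto simp: pair_graph_iff dest: symD)
    ultimately show "(b, a) \<in> parcs (contract_edge H u v)"
      unfolding contract_edge_def Let_def pair_pre_digraph.simps
      by (intro CollectI exI[of _ y] exI[of _ x]) simp
  qed
  moreover have "u \<noteq> v" "u \<in> pverts H"
    using H contract_edge.hyps by (auto simp: pair_graph_iff)
  ultimately show ?case
    using H unfolding pair_graph_iff by (auto simp: contract_edge_def Let_def)
qed (auto simp: pair_graph_iff delete_edge_def delete_vertex_def sym_def)

text \<open>The extrema in the definitions of the three parameters are attained.\<close>

lemma hadwiger_wf:
  assumes "pair_graph G"
  shows "finite {t. \<exists>H. graph_minor G H \<and> K\<^bsub>t\<^esub> (with_proj H)}"
proof (rule finite_subset)
  show "{t. \<exists>H. graph_minor G H \<and> K\<^bsub>t\<^esub> (with_proj H)} \<subseteq> {..card (pverts G)}"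
  proof
    fix t assume "t \<in> {t. \<exists>H. graph_minor G H \<and> K\<^bsub>t\<^esub> (with_proj H)}"
    then obtain H where "graph_minor G H" "K\<^bsub>t\<^esub> (with_proj H)" by blast
    then have "pverts H \<subseteq> pverts G" "card (pverts H) = t"
      using assms graph_minor_pair_graph by (blast, simp add: complete_digraph_pair_def)
    then show "t \<in> {..card (pverts G)}"
      using assms card_mono by (auto simp: pair_graph_iff)
  qed
qed simp

lemma max_nullity_wf:
  assumes "pair_graph G"
  shows "finite (kernel_dim ` graph_matrices G)" "graph_matrices G \<noteq> {}"
proof -
  have "kernel_dim ` graph_matrices G \<subseteq> {..card (pverts G)}"
    by (auto simp: graph_matrices_def kernel_dim_code)
  then show "finite (kernel_dim ` graph_matrices G)"
    by (rule finite_subset) simp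
  let ?n = "card (pverts G)"
  obtain f where f: "bij_betw f {..<?n} (pverts G)"
    using assms by (metis ex_bij_betw_nat_finite atLeast0LessThan pair_graph_iff)
  define A where "A = mat ?n ?n (\<lambda>(i, j). if (f i, f j) \<in> parcs G then 1 else 0 :: real)"
  have "A\<^sup>T = A"
    using assms by (intro eq_matI) (auto simp: A_def pair_graph_iff sym_def)
  then have "A \<in> graph_matrices G"
    using f by (auto simp: graph_matrices_def A_def intro!: exI[of _ f])
  then show "graph_matrices G \<noteq> {}" by blast
qed

lemma zero_forcing_wf:
  assumes "pair_graph G"
  shows "finite {B. zero_forcing_set G B}" "zero_forcing_set G (pverts G)"
  using assms by (auto simp: zero_forcing_set_def pair_graph_iff)

end

theory Submission
  imports Defs
begin

text \<open>
  The equality for \<open>M\<close> and \<open>Z\<close> is squeezed out of \<open>k \<le> M(G) \<le> Z(G) \<le> k\<close>. A \<open>k\<close>-tree on \<open>n\<close>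
  vertices has \<open>n - k\<close> cliques of size \<open>k + 1\<close> covering exactly its edges, and their vertex-clique
  incidence matrix \<open>N\<close> gives the matrix \<open>N\<^sup>T N\<close> of rank at most \<open>n - k\<close> with the pattern of \<open>G\<close>. A kernel
  vector vanishing on a zero forcing set vanishes everywhere, whence \<open>M(G) \<le> Z(G)\<close>. In a linear
  \<open>k\<close>-tree, removing a vertex \<open>a\<close> of degree \<open>k\<close> leaves a linear \<open>k\<close>-tree in which the neighbourhood
  of \<open>a\<close> is a \<open>k\<close>-clique containing again a vertex of degree \<open>k\<close>; hence by induction every \<open>k\<close>-clique
  containing a vertex of degree \<open>k\<close> is zero forcing. Finally \<open>h(G) = k + 1\<close>: when a simplicial
  vertex of degree \<open>k\<close> is deleted, the branch sets of a \<open>K\<^bsub>k+2\<^esub>\<close> minor stay connected and pairwise adjacent,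
  and none of them is that single vertex because it has only \<open>k\<close> neighbours.
\<close>

section \<open>Nullity of matrices\<close>

text \<open>The echelon form has at most \<open>nr\<close> pivots, so some column carries none; the
  basis vector belonging to this free column is the witness.\<close>

lemma exists_nonzero_kernel_vec:
  fixes A :: "'a :: field mat"
  assumes A: "A \<in> carrier_mat nr nc" and less: "nr < nc"
  obtains x where "x \<in> carrier_vec nc" "x \<noteq> 0\<^sub>v nc" "A *\<^sub>v x = 0\<^sub>v nr"
proof -
  let ?C = "gauss_jordan_single A"
  note gj = gauss_jordan_single[OF A HOL.refl]
  obtain p where "pivot_fun ?C p nc"
    using gj(2,3) by (auto simp: row_echelon_form_def)
  note len = pivot_positions(4)[OF gj(2) this]
  have "card {i. i < nr \<and> row ?C i \<noteq> 0\<^sub>v nc} \<le> card {..<nr}"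
    by (intro card_mono) auto
  moreover have "card (snd ` set (pivot_positions ?C)) \<le> length (pivot_positions ?C)"
    by (meson card_image_le card_length finite_set le_trans)
  ultimately have "card (snd ` set (pivot_positions ?C)) < card {0..<nc}"
    using len less by simp
  then have "snd ` set (pivot_positions ?C) \<noteq> {0..<nc}"
    by (metis less_irrefl)
  note find_base_vector[OF gj(3,2) this]
  with gj(1) that show thesis by blast
qed

lemma kernel_dim_eq_nonzero_rows:
  assumes A: "A \<in> carrier_mat nr nc"
  shows "kernel_dim A = nc - card {i. i < nr \<and> row (gauss_jordan_single A) i \<noteq> 0\<^sub>v nc}"
proof -
  note gj = gauss_jordan_single[OF A HOL.refl]
  obtain p where "pivot_fun (gauss_jordan_single A) p nc"
    using gj(2,3) by (auto simp: row_echelon_form_def)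
  from pivot_positions(4)[OF gj(2) this] A show ?thesis
    by (simp add: kernel_dim_code)
qed

lemma kernel_dim_ge:
  assumes A: "A \<in> carrier_mat nr nc"
  shows "nc - nr \<le> kernel_dim A"
proof -
  have "card {i. i < nr \<and> row (gauss_jordan_single A) i \<noteq> 0\<^sub>v nc} \<le> card {..<nr}"
    by (intro card_mono) auto
  then show ?thesis
    by (simp add: kernel_dim_eq_nonzero_rows[OF A])
qed

text \<open>With nullity above \<open>card I\<close>, rank plus \<open>card I\<close> would stay
  below \<open>nc\<close>, so some nonzero kernel vector would vanish on all of \<open>I\<close>,
  against \<open>zero\<close>.\<close>

lemma kernel_dim_le_card:
  fixes A :: "'a :: field mat"
  assumes A: "A \<in> carrier_mat nr nc" and fin: "finite I" and I: "I \<subseteq> {..<nc}"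
    and zero: "\<And>x. \<lbrakk>x \<in> carrier_vec nc; A *\<^sub>v x = 0\<^sub>v nr; \<forall>i\<in>I. x $ i = 0\<rbrakk> \<Longrightarrow> x = 0\<^sub>v nc"
  shows "kernel_dim A \<le> card I"
proof (rule ccontr)
  assume contra: "\<not> kernel_dim A \<le> card I"
  let ?C = "gauss_jordan_single A"
  let ?R = "{i. i < nr \<and> row ?C i \<noteq> 0\<^sub>v nc}"
  note gj = gauss_jordan_single[OF A HOL.refl]
  \<comment> \<open>the nonzero rows of the echelon form stacked on the coordinate functionals of \<open>I\<close>: fewer than \<open>nc\<close> rows\<close>
  define rs where "rs = map (row ?C) (sorted_list_of_set ?R) @ map (unit_vec nc) (sorted_list_of_set I)"
  have len: "length rs = card ?R + card I"
    using fin by (simp add: rs_def)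
  have rs: "set rs = row ?C ` ?R \<union> unit_vec nc ` I"
    using fin by (simp add: rs_def)
  have "length rs < nc"
    using contra len kernel_dim_eq_nonzero_rows[OF A] by simp
  from exists_nonzero_kernel_vec[OF mat_of_rows_carrier(1) this]
  obtain x where x: "x \<in> carrier_vec nc" "x \<noteq> 0\<^sub>v nc" "mat_of_rows nc rs *\<^sub>v x = 0\<^sub>v (length rs)"
    by blast
  have orth: "r \<bullet> x = 0" if "r \<in> set rs" for r
  proof -
    obtain i where i: "i < length rs" "r = rs ! i"
      using \<open>r \<in> set rs\<close> by (metis in_set_conv_nth)
    have "r \<in> carrier_vec nc"
      using that rs gj(2) by auto
    then have "(mat_of_rows nc rs *\<^sub>v x) $ i = r \<bullet> x"
      using i by simp
    then show ?thesis
      using i x(3) by simp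
  qed
  have "?C *\<^sub>v x = 0\<^sub>v nr"
  proof (rule eq_vecI)
    fix i assume "i < dim_vec (0\<^sub>v nr :: 'a vec)"
    then have i: "i < nr" by simp
    have "row ?C i \<bullet> x = 0"
    proof (cases "row ?C i = 0\<^sub>v nc")
      case True
      then show ?thesis using x(1) by simp
    next
      case False
      then show ?thesis using i orth rs by blast
    qed
    then show "(?C *\<^sub>v x) $ i = 0\<^sub>v nr $ i"
      using i gj(2) by simp
  qed (use gj(2) in simp)
  moreover have "x $ i = 0" if "i \<in> I" for i
    using orth[of "unit_vec nc i"] that I x(1) rs by auto
  \<comment> \<open>Row reduction preserves the kernel, so \<open>A\<close> annihilates
    \<open>x\<close> as well.\<close>
  ultimately have "x = 0\<^sub>v nc"
    using zero x(1) gj(1) by blast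
  with x(2) show False by simp
qed

text \<open>For \<open>y = N x\<close>, the scalar product of \<open>y\<close> with itself equals
  that of \<open>x\<close> with \<open>N\<^sup>T y = 0\<close>; a real sum of squares vanishes only
  termwise.\<close>

lemma mat_kernel_transpose_mult:
  fixes N :: "real mat"
  assumes N: "N \<in> carrier_mat m n"
  shows "mat_kernel (N\<^sup>T * N) = mat_kernel N"
proof
  have NN: "N\<^sup>T * N \<in> carrier_mat n n" using N by simp
  show "mat_kernel (N\<^sup>T * N) \<subseteq> mat_kernel N"
  proof
    fix x assume "x \<in> mat_kernel (N\<^sup>T * N)"
    then have x: "x \<in> carrier_vec n" "(N\<^sup>T * N) *\<^sub>v x = 0\<^sub>v n"
      using mat_kernelD[OF NN] by auto
    let ?y = "N *\<^sub>v x"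
    have y: "?y \<in> carrier_vec m" using N x by simp
    have "N\<^sup>T *\<^sub>v ?y = 0\<^sub>v n"
      using x N by (metis assoc_mult_mat_vec transpose_carrier_mat)
    then have "?y \<bullet> ?y = 0"
      using transpose_vec_mult_scalar[OF N x(1) y] x(1) by simp
    then have "\<forall>i<m. ?y $ i = 0"
      using y N by (simp add: scalar_prod_def sum_nonneg_eq_0_iff)
    then have "?y = 0\<^sub>v m"
      using y N by (intro eq_vecI) (auto simp del: index_mult_mat_vec)
    then show "x \<in> mat_kernel N"
      using mat_kernelI[OF N x(1)] by simp
  qed
  show "mat_kernel N \<subseteq> mat_kernel (N\<^sup>T * N)"
    using mat_kernel_mult_subset[OF N, of "N\<^sup>T" n] N by simp
qed

lemma kernel_dim_transpose_mult_ge: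
  fixes N :: "real mat"
  assumes N: "N \<in> carrier_mat m n"
  shows "n - m \<le> kernel_dim (N\<^sup>T * N)"
proof -
  have "kernel_dim (N\<^sup>T * N) = kernel_dim N"
    using N by (simp add: kernel_dim_def mat_kernel_transpose_mult)
  then show ?thesis
    using kernel_dim_ge[OF N] by simp
qed

section \<open>Zero forcing bounds the nullity\<close>

text \<open>In the row of \<open>A x = 0\<close> that belongs to a forcing vertex, every term but
  that of the forced vertex already vanishes, and the coefficient there is nonzero.\<close>

lemma zero_forcing_vanish:
  fixes A :: "real mat"
  assumes A: "A \<in> carrier_mat n n"
    and f: "bij_betw f {..<n} (pverts G)"
    and pat: "\<And>i j. \<lbrakk>i < n; j < n; i \<noteq> j\<rbrakk> \<Longrightarrow> A $$ (i, j) \<noteq> 0 \<longleftrightarrow> (f i, f j) \<in> parcs G"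
    and G: "pair_graph G"
    and x: "x \<in> carrier_vec n" "A *\<^sub>v x = 0\<^sub>v n"
    and steps: "(forces G)\<^sup>*\<^sup>* B B'"
    and "B \<subseteq> pverts G" "\<forall>i<n. f i \<in> B \<longrightarrow> x $ i = 0"
  shows "B' \<subseteq> pverts G \<and> (\<forall>i<n. f i \<in> B' \<longrightarrow> x $ i = 0)"
  using steps
proof (induction rule: rtranclp_induct)
  case base
  then show ?case using assms by blast
next
  case (step B' B'')
  then obtain v u where vu: "v \<in> B'" "{w. (v, w) \<in> parcs G} - B' = {u}" "B'' = insert u B'"
    by (auto simp: forces_def)
  then have u: "(v, u) \<in> parcs G" "u \<notin> B'" by auto
  then have verts: "v \<in> pverts G" "u \<in> pverts G"
    using G by (auto simp: pair_graph_iff)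
  obtain i where i: "i < n" "f i = v"
    using f verts(1) unfolding bij_betw_def by (metis imageE lessThan_iff)
  obtain j where j: "j < n" "f j = u"
    using f verts(2) unfolding bij_betw_def by (metis imageE lessThan_iff)
  have ij: "i \<noteq> j" using i j u vu by auto
  have "x $ j = 0"
  proof -
    have "0 = (A *\<^sub>v x) $ i" using x i by simp
    also have "\<dots> = (\<Sum>l\<in>{0..<n}. A $$ (i, l) * x $ l)"
      using A x(1) i by (auto simp: scalar_prod_def intro!: sum.cong)
    also have "\<dots> = (\<Sum>l\<in>{j}. A $$ (i, l) * x $ l)"
    proof (rule sum.mono_neutral_right)
      show "\<forall>l\<in>{0..<n} - {j}. A $$ (i, l) * x $ l = 0"
      proof
        fix l assume l: "l \<in> {0..<n} - {j}"
        then have "f l \<noteq> u"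
          using f j by (auto simp: bij_betw_def inj_on_def)
        \<comment> \<open>The diagonal entry, on which the pattern says nothing, is covered by the
          second alternative: for \<open>l = i\<close> the vertex \<open>f l = v\<close> is
          filled.\<close>
        then have "A $$ (i, l) = 0 \<or> f l \<in> B'"
          using vu i l pat[of i l] by auto
        then show "A $$ (i, l) * x $ l = 0"
          using step.IH l by auto
      qed
    qed (use j in auto)
    finally have "A $$ (i, j) * x $ j = 0" by simp
    then show ?thesis
      using pat[OF i(1) j(1) ij] u i j by simp
  qed
  moreover have "l = j" if "l < n" "f l = u" for l
    using that f j by (auto simp: bij_betw_def inj_on_def)
  ultimately show ?case
    using step.IH vu verts by auto
qed

lemma nullity_le_zero_forcing:
  assumes G: "pair_graph G" and A: "A \<in> graph_matrices G" and B: "zero_forcing_set G B"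
  shows "kernel_dim A \<le> card B"
proof -
  let ?n = "card (pverts G)"
  obtain f where f: "bij_betw f {..<?n} (pverts G)"
    and pat: "\<forall>i<?n. \<forall>j<?n. i \<noteq> j \<longrightarrow> (A $$ (i, j) \<noteq> 0 \<longleftrightarrow> (f i, f j) \<in> parcs G)"
    and car: "A \<in> carrier_mat ?n ?n"
    using A by (auto simp: graph_matrices_def)
  have sub: "B \<subseteq> pverts G" and steps: "(forces G)\<^sup>*\<^sup>* B (pverts G)"
    using B by (auto simp: zero_forcing_set_def)
  define I where "I = {i. i < ?n \<and> f i \<in> B}"
  have "f ` I = B"
    using f sub by (auto simp: I_def bij_betw_def)
  moreover have "inj_on f I"
    using f by (auto simp: I_def bij_betw_def inj_on_def)
  ultimately have cardI: "card I = card B"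
    by (metis card_image)
  have "kernel_dim A \<le> card I"
  proof (rule kernel_dim_le_card[OF car])
    fix x :: "real vec"
    assume x: "x \<in> carrier_vec ?n" "A *\<^sub>v x = 0\<^sub>v ?n" "\<forall>i\<in>I. x $ i = 0"
    then have "\<forall>i<?n. f i \<in> pverts G \<longrightarrow> x $ i = 0"
      using zero_forcing_vanish[OF car f _ G x(1,2) steps sub] pat by (auto simp: I_def)
    then show "x = 0\<^sub>v ?n"
      using x(1) f by (intro eq_vecI) (auto simp: bij_betw_def)
  qed (auto simp: I_def)
  with cardI show ?thesis by simp
qed

section \<open>Structure of \<open>k\<close>-trees\<close>

definition nbrs :: "'a pair_pre_digraph \<Rightarrow> 'a \<Rightarrow> 'a set" where
  "nbrs G v = {w. (v, w) \<in> parcs G}"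

definition is_clique :: "'a pair_pre_digraph \<Rightarrow> 'a set \<Rightarrow> bool" where
  "is_clique G Q \<longleftrightarrow> Q \<subseteq> pverts G \<and> (\<forall>x\<in>Q. \<forall>y\<in>Q. x \<noteq> y \<longrightarrow> (x, y) \<in> parcs G)"

definition attach :: "'a \<Rightarrow> 'a set \<Rightarrow> 'a pair_pre_digraph \<Rightarrow> 'a pair_pre_digraph" where
  "attach v Q G = \<lparr>pverts = insert v (pverts G), parcs = parcs G \<union> {v} \<times> Q \<union> Q \<times> {v}\<rparr>"

text \<open>In a \<open>k\<close>-tree every degree is at least \<open>k\<close>; the vertices of degree exactly \<open>k\<close> play the role of leaves.\<close>

definition leaves :: "nat \<Rightarrow> 'a pair_pre_digraph \<Rightarrow> 'a set" where
  "leaves k G = {v \<in> pverts G. card (nbrs G v) = k}"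

lemma attach_simps [simp]:
  "pverts (attach v Q G) = insert v (pverts G)"
  "parcs (attach v Q G) = parcs G \<union> {v} \<times> Q \<union> Q \<times> {v}"
  by (simp_all add: attach_def)

lemma out_degree_eq_card_nbrs: "out_degree (with_proj G) v = card (nbrs G v)"
proof -
  have "out_arcs (with_proj G) v = Pair v ` nbrs G v"
    by (auto simp: out_arcs_def nbrs_def)
  then show ?thesis
    by (simp add: out_degree_def card_image inj_on_def)
qed

lemma complete_iff_clique:
  assumes "pair_graph G"
  shows "K\<^bsub>n\<^esub> (with_proj G) \<longleftrightarrow> card (pverts G) = n \<and> is_clique G (pverts G)"
proof -
  have "parcs G = {(u, v). (u, v) \<in> pverts G \<times> pverts G \<and> u \<noteq> v} \<longleftrightarrow> is_clique G (pverts G)"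
    using assms unfolding pair_graph_iff is_clique_def by blast
  then show ?thesis
    using assms by (simp add: complete_digraph_pair_def pair_graph_iff)
qed

lemma complete_induced_iff_clique:
  assumes G: "pair_graph G" and Q: "Q \<subseteq> pverts G"
  shows "K\<^bsub>n\<^esub> (with_proj G \<restriction> Q) \<longleftrightarrow> card Q = n \<and> is_clique G Q"
proof -
  let ?H = "\<lparr>pverts = Q, parcs = {(x, y) \<in> parcs G. x \<in> Q \<and> y \<in> Q}\<rparr>"
  have "with_proj G \<restriction> Q = with_proj ?H"
    by (auto simp: induce_subgraph_def with_proj_def)
  moreover have "pair_graph ?H"
    using G Q by (auto simp: pair_graph_iff sym_def intro: finite_subset)
  ultimately have "K\<^bsub>n\<^esub> (with_proj G \<restriction> Q) \<longleftrightarrow> card Q = n \<and> is_clique ?H Q"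
    by (simp add: complete_iff_clique)
  also have "is_clique ?H Q \<longleftrightarrow> is_clique G Q"
    using Q by (auto simp: is_clique_def)
  finally show ?thesis .
qed

lemma k_tree_attach:
  assumes "k_tree k G" "is_clique G Q" "card Q = k" "v \<notin> pverts G"
  shows "k_tree k (attach v Q G)"
  using assms k_tree.add_vertex[of k G Q v] k_tree_pair_graph[of k G]
  by (simp add: complete_induced_iff_clique is_clique_def attach_def)

lemma k_tree_attach_induct [consumes 1, case_names complete attach]:
  assumes "k_tree k G"
    and complete: "\<And>G. \<lbrakk>pair_graph G; card (pverts G) = k + 1; is_clique G (pverts G)\<rbrakk> \<Longrightarrow> P G"
    and attach: "\<And>G Q v. \<lbrakk>k_tree k G; pair_graph G; is_clique G Q; finite Q; card Q = k;
      v \<notin> pverts G; P G\<rbrakk> \<Longrightarrow> P (attach v Q G)"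
  shows "P G"
  using assms(1)
proof (induction rule: k_tree.induct)
  case (clique G)
  then have "pair_graph G"
    by (intro k_tree_pair_graph k_tree.clique)
  with clique complete show ?case
    by (simp add: complete_iff_clique)
next
  case (add_vertex G Q v)
  then have G: "pair_graph G"
    by (intro k_tree_pair_graph)
  then have "finite Q"
    using add_vertex by (auto simp: pair_graph_iff intro: finite_subset)
  with add_vertex G attach[of G Q v] show ?case
    by (simp add: complete_induced_iff_clique attach_def)
qed

lemma k_tree_card: "k_tree k G \<Longrightarrow> k + 1 \<le> card (pverts G)"
  by (induction rule: k_tree_attach_induct) (auto simp: pair_graph_iff)

lemma k_tree_complete:
  assumes "k_tree k G" "card (pverts G) = k + 1"
  shows "is_clique G (pverts G)"
  using assms
proof (induction rule: k_tree_attach_induct)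
  case (attach G Q v)
  then show ?case
    using k_tree_card[of k G] by (auto simp: pair_graph_iff)
qed

lemma nbrs_subset: "pair_graph G \<Longrightarrow> nbrs G v \<subseteq> pverts G"
  by (auto simp: nbrs_def pair_graph_iff)

lemma finite_nbrs: "pair_graph G \<Longrightarrow> finite (nbrs G v)"
  by (meson finite_subset nbrs_subset pair_graph_iff)

lemma nbrs_attach_new:
  "\<lbrakk>pair_graph G; v \<notin> pverts G; Q \<subseteq> pverts G\<rbrakk> \<Longrightarrow> nbrs (attach v Q G) v = Q"
  by (auto simp: nbrs_def pair_graph_iff)

lemma nbrs_attach_old:
  "x \<noteq> v \<Longrightarrow> nbrs (attach v Q G) x = nbrs G x \<union> (if x \<in> Q then {v} else {})"
  by (auto simp: nbrs_def)

lemma card_nbrs_attach_old: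
  assumes "pair_graph G" "v \<notin> pverts G" "x \<noteq> v"
  shows "card (nbrs (attach v Q G) x) = card (nbrs G x) + (if x \<in> Q then 1 else 0)"
proof -
  have "v \<notin> nbrs G x" "finite (nbrs G x)"
    using assms nbrs_subset[of G x] finite_nbrs[of G x] by auto
  then show ?thesis
    using assms(3) by (simp add: nbrs_attach_old)
qed

section \<open>Degrees and vertices of minimum degree\<close>

lemma nbrs_complete:
  assumes "pair_graph G" "is_clique G (pverts G)" "v \<in> pverts G"
  shows "nbrs G v = pverts G - {v}"
  using assms by (auto simp: nbrs_def is_clique_def pair_graph_iff)

lemma k_tree_degree_ge: "k_tree k G \<Longrightarrow> v \<in> pverts G \<Longrightarrow> k \<le> card (nbrs G v)"
proof (induction rule: k_tree_attach_induct)
  case (complete G)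
  then show ?case by (simp add: nbrs_complete pair_graph_iff)
next
  case (attach G Q u)
  then show ?case
    by (cases "v = u") (auto simp: nbrs_attach_new card_nbrs_attach_old is_clique_def)
qed

lemma leaves_complete:
  assumes "pair_graph G" "is_clique G (pverts G)" "card (pverts G) = k + 1"
  shows "leaves k G = pverts G"
  using assms by (auto simp: leaves_def nbrs_complete pair_graph_iff)

text \<open>A vertex of \<open>Q\<close> had degree at least \<open>k\<close> and gains a neighbour,
  so it is no leaf afterwards; the other old vertices keep their degree and \<open>v\<close> gets
  exactly \<open>k\<close>.\<close>

lemma leaves_attach:
  assumes G: "k_tree k G" and Q: "is_clique G Q" "card Q = k" and v: "v \<notin> pverts G"
  shows "leaves k (attach v Q G) = insert v (leaves k G - Q)"
proof -
  have pg: "pair_graph G" using G by (rule k_tree_pair_graph)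
  have "Q \<subseteq> pverts G" using Q by (simp add: is_clique_def)
  have "x \<in> leaves k (attach v Q G) \<longleftrightarrow> x \<in> insert v (leaves k G - Q)" for x
  proof (cases "x = v")
    case True
    then show ?thesis
      using pg v Q \<open>Q \<subseteq> pverts G\<close> by (simp add: leaves_def nbrs_attach_new)
  next
    case False
    then show ?thesis
      using pg v k_tree_degree_ge[OF G, of x] by (auto simp: leaves_def card_nbrs_attach_old)
  qed
  then show ?thesis by blast
qed

lemma leaf_in_clique_unique:
  assumes "is_clique G Q" "\<forall>x\<in>leaves k G. \<forall>y\<in>leaves k G. (x, y) \<notin> parcs G"
  shows "card (leaves k G \<inter> Q) \<le> 1"
proof -
  have "x = y" if "x \<in> leaves k G \<inter> Q" "y \<in> leaves k G \<inter> Q" for x y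
    using that assms unfolding is_clique_def by blast
  then show ?thesis
    by (cases "finite (leaves k G \<inter> Q)") (auto simp: card_le_Suc0_iff_eq)
qed

lemma finite_leaves: "pair_graph G \<Longrightarrow> finite (leaves k G)"
  by (simp add: leaves_def pair_graph_iff)

text \<open>A clique \<open>Q\<close> meets an independent set of leaves at most once, so an old
  leaf survives outside \<open>Q\<close>; it is not adjacent to the new vertex and forms a pair of
  leaves with it.\<close>

lemma leaves_independent:
  assumes "k_tree k G" "card (pverts G) \<noteq> k + 1"
  shows "2 \<le> card (leaves k G) \<and> (\<forall>x\<in>leaves k G. \<forall>y\<in>leaves k G. (x, y) \<notin> parcs G)"
  using assms
proof (induction rule: k_tree_attach_induct)
  case (complete G)
  then show ?case by simp
next
  case (attach G Q v)
  note leaves = leaves_attach[OF attach(1,3,5,6)]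
  have Q: "Q \<subseteq> pverts G" using attach by (simp add: is_clique_def)
  have v: "v \<notin> leaves k G" using attach by (simp add: leaves_def)
  have fin: "finite (leaves k G)" by (rule finite_leaves[OF attach(2)])
  have *: "1 \<le> card (leaves k G - Q) \<and>
    (\<forall>x\<in>leaves k G - Q. \<forall>y\<in>leaves k G - Q. (x, y) \<notin> parcs G)"
  \<comment> \<open>The initial clique is outside the induction hypothesis: all its
    \<open>k + 1\<close> vertices are leaves, and exactly one of them avoids
    \<open>Q\<close>.\<close>
  proof (cases "card (pverts G) = k + 1")
    case True
    then have all: "leaves k G = pverts G"
      using leaves_complete[OF attach(2)] k_tree_complete[OF attach(1)] by simp
    have "card (pverts G - Q) = 1"
      using True Q attach(4,5) by (simp add: card_Diff_subset)
    moreover obtain z where "pverts G - Q = {z}"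
      using calculation card_1_singletonE by blast
    ultimately show ?thesis
      using attach(2) all by (simp add: pair_graph_iff)
  next
    case False
    note IH = attach.IH[OF False]
    have "card (leaves k G \<inter> Q) \<le> 1"
      using leaf_in_clique_unique[OF attach(3)] IH by blast
    moreover have "card (leaves k G - Q) = card (leaves k G) - card (leaves k G \<inter> Q)"
      using fin by (simp add: card_Diff_subset_Int)
    ultimately show ?thesis
      using IH by auto
  qed
  have "card (leaves k (attach v Q G)) = Suc (card (leaves k G - Q))"
    using leaves fin v by simp
  moreover have "(x, y) \<notin> parcs (attach v Q G)"
    if "x \<in> leaves k (attach v Q G)" "y \<in> leaves k (attach v Q G)" for x y
    using that * Q attach(2,6) unfolding leaves by (auto simp: pair_graph_iff)
  ultimately show ?case
    using * by (metis One_nat_def Suc_1 Suc_le_mono)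
qed

text \<open>The order of attachment is flexible: a leaf \<open>a\<close> other than the last vertex
  \<open>v\<close> lies outside \<open>Q\<close>, hence is not adjacent to \<open>v\<close>, and the
  two can be exchanged.\<close>

lemma k_tree_remove_leaf:
  assumes "k_tree k G" "card (pverts G) \<noteq> k + 1" "a \<in> leaves k G"
  obtains H Q where "k_tree k H" "is_clique H Q" "card Q = k" "a \<notin> pverts H" "G = attach a Q H"
proof -
  have "\<exists>H Q. k_tree k H \<and> is_clique H Q \<and> card Q = k \<and> a \<notin> pverts H \<and> G = attach a Q H"
    using assms
  proof (induction rule: k_tree_attach_induct)
    case (complete G)
    then show ?case by simp
  next
    case (attach G Q v)
    have Q: "Q \<subseteq> pverts G" using attach by (simp add: is_clique_def)
    consider "a = v" | "a \<noteq> v" "a \<in> leaves k G" "a \<notin> Q"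
      using attach.prems leaves_attach[OF attach(1,3,5,6)] by auto
    then show ?case
    proof cases
      case 1
      then show ?thesis using attach by blast
    next
      case 2
      have a: "a \<in> pverts G" using 2 by (simp add: leaves_def)
      show ?thesis
      proof (cases "card (pverts G) = k + 1")
        case True
        \<comment> \<open>Over the initial clique, \<open>a\<close> and \<open>v\<close> are twins,
          both joined exactly to \<open>Q\<close>, so \<open>v\<close> together with
          \<open>Q\<close> can serve as the initial clique instead.\<close>
        have "Q = pverts G - {a}"
          using Q 2 a True attach by (intro card_subset_eq) (auto simp: pair_graph_iff)
        define H where "H = \<lparr>pverts = insert v Q, parcs = {(x, y). x \<in> insert v Q \<and> y \<in> insert v Q \<and> x \<noteq> y}\<rparr>"
        have "k_tree k H"
          using attach(4,5,6) Q
          by (intro k_tree.clique) (auto simp: H_def complete_digraph_pair_def card_insert_if)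
        moreover have "is_clique H Q"
          by (auto simp: H_def is_clique_def)
        moreover have "parcs G = {(x, y). x \<in> pverts G \<and> y \<in> pverts G \<and> x \<noteq> y}"
          using k_tree_complete[OF attach(1) True] attach(2) by (auto simp: is_clique_def pair_graph_iff)
        then have "attach v Q G = attach a Q H"
          using \<open>Q = pverts G - {a}\<close> a attach(6) by (auto simp: attach_def H_def)
        moreover have "a \<notin> pverts H"
          using 2 by (simp add: H_def)
        ultimately show ?thesis
          using attach(5) by blast
      next
        case False
        from attach.IH[OF False 2(2)] obtain H R where H: "k_tree k H" "is_clique H R" "card R = k"
          "a \<notin> pverts H" "G = attach a R H" by blast
        \<comment> \<open>As \<open>a\<close> is not in \<open>Q\<close>, this clique existed before
          \<open>a\<close> was attached; so \<open>v\<close> can be attached to \<open>H\<close>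
          first and \<open>a\<close> afterwards.\<close>
        have "is_clique H Q"
          using attach(3) H(5) 2 by (auto simp: is_clique_def)
        then have "k_tree k (attach v Q H)"
          using H attach by (intro k_tree_attach) auto
        moreover have "is_clique (attach v Q H) R"
          using H(2) by (auto simp: is_clique_def)
        moreover have "attach v Q G = attach a R (attach v Q H)"
          using H(5) by (auto simp: attach_def)
        ultimately show ?thesis
          using H 2 by (intro exI[of _ "attach v Q H"] exI[of _ R]) auto
      qed
    qed
  qed
  with that show thesis by blast
qed

section \<open>Zero forcing in linear \<open>k\<close>-trees\<close>

text \<open>As \<open>a\<close> is already filled, its new edges give no vertex of \<open>H\<close>
  a further unfilled neighbour.\<close>

lemma forces_attach:
  assumes "forces H B B'" "pair_graph H" "a \<notin> pverts H"
  shows "forces (attach a R H) (insert a B) (insert a B')"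
proof -
  obtain v u where vu: "v \<in> B" "{w. (v, w) \<in> parcs H} - B = {u}" "B' = insert u B"
    using assms(1) by (auto simp: forces_def)
  then have "v \<noteq> a" "u \<noteq> a"
    using assms(2,3) by (auto simp: pair_graph_iff)
  then have "{w. (v, w) \<in> parcs (attach a R H)} - insert a B = {u}"
    using vu(2) by auto
  then show ?thesis
    using vu unfolding forces_def by (intro bexI[of _ v] exI[of _ u]) auto
qed

lemma forces_attach_rtranclp:
  assumes "(forces H)\<^sup>*\<^sup>* B B'" "pair_graph H" "a \<notin> pverts H"
  shows "(forces (attach a R H))\<^sup>*\<^sup>* (insert a B) (insert a B')"
  using assms(1)
proof (induction rule: rtranclp_induct)
  case base
  show ?case ..
next
  case (step C D)
  from step.IH forces_attach[OF step.hyps(2) assms(2,3)] show ?case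
    by (rule rtranclp.rtrancl_into_rtrancl)
qed

text \<open>The leaf \<open>a\<close> has \<open>k\<close> neighbours, \<open>k - 1\<close> of them
  in \<open>Q\<close>, so it forces the remaining one. Afterwards \<open>a\<close> stays filled and
  the process continues from its neighbourhood in the graph without \<open>a\<close>.\<close>

lemma leaf_clique_forces:
  assumes "k \<ge> 1" "k_tree k G" "card (pverts G) = k + 1 \<or> card (leaves k G) = 2"
    "is_clique G Q" "card Q = k" "a \<in> Q" "a \<in> leaves k G"
  shows "(forces G)\<^sup>*\<^sup>* Q (pverts G)"
  using assms
proof (induction "card (pverts G)" arbitrary: G Q a rule: less_induct)
  case less
  have pg: "pair_graph G" by (rule k_tree_pair_graph) fact
  have Q: "Q \<subseteq> pverts G" using less.prems by (simp add: is_clique_def)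
  have finQ: "finite Q" using Q pg by (auto simp: pair_graph_iff intro: finite_subset)
  show ?case
  proof (cases "card (pverts G) = k + 1")
    case True
    then have "card (pverts G - Q) = 1"
      using Q finQ less.prems by (simp add: card_Diff_subset)
    then obtain u where u: "pverts G - Q = {u}"
      using card_1_singletonE by blast
    have "nbrs G a = pverts G - {a}"
      using nbrs_complete[OF pg] k_tree_complete[OF _ True] less.prems Q by blast
    then have "{w. (a, w) \<in> parcs G} - Q = {u}"
      using u less.prems by (auto simp: nbrs_def)
    moreover have "pverts G = insert u Q"
      using u Q by auto
    ultimately have "forces G Q (pverts G)"
      using \<open>a \<in> Q\<close> unfolding forces_def by blast
    then show ?thesis by blast
  next
    case False
    from k_tree_remove_leaf[OF \<open>k_tree k G\<close> False \<open>a \<in> leaves k G\<close>]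
    obtain H R where H: "k_tree k H" and R: "is_clique H R" "card R = k" and a: "a \<notin> pverts H"
      and G: "G = attach a R H" by blast
    have pgH: "pair_graph H" using H by (rule k_tree_pair_graph)
    have RH: "R \<subseteq> pverts H" using R by (simp add: is_clique_def)
    have finR: "finite R" using R \<open>k \<ge> 1\<close> by (simp add: card_ge_0_finite)
    have nb: "nbrs G a = R"
      unfolding G using nbrs_attach_new[OF pgH a RH] .
    have QR: "Q - {a} \<subseteq> R"
      using less.prems nb by (auto simp: is_clique_def nbrs_def)
    have "card (R - (Q - {a})) = 1"
      using QR R finR less.prems finQ by (simp add: card_Diff_subset)
    then obtain y where y: "R - (Q - {a}) = {y}"
      using card_1_singletonE by blast
    have "a \<notin> R" using a RH by blast
    then have "{w. (a, w) \<in> parcs G} - Q = {y}"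
      using nb y by (auto simp: nbrs_def)
    moreover have "insert y Q = insert a R"
      using y QR \<open>a \<in> Q\<close> by auto
    ultimately have step: "forces G Q (insert a R)"
      using \<open>a \<in> Q\<close> unfolding forces_def by metis
    have leavesG: "leaves k G = insert a (leaves k H - R)"
      unfolding G by (rule leaves_attach[OF H R a])
    have fin: "finite (leaves k H)" by (rule finite_leaves[OF pgH])
    \<comment> \<open>The induction hypothesis for \<open>H\<close> requires that \<open>H\<close>
      is again linear and that \<open>R\<close> contains one of its leaves.\<close>
    have "(card (pverts H) = k + 1 \<or> card (leaves k H) = 2) \<and> leaves k H \<inter> R \<noteq> {}"
    proof (cases "card (pverts H) = k + 1")
      case True
      then have "leaves k H = pverts H"
        using leaves_complete[OF pgH] k_tree_complete[OF H] by simp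
      moreover have "R \<noteq> {}" using R(2) \<open>k \<ge> 1\<close> by auto
      ultimately show ?thesis using True RH by blast
    next
      case nc: False
      note ind = leaves_independent[OF H nc]
      have "card (leaves k H \<inter> R) \<le> 1"
        using leaf_in_clique_unique[OF R(1)] ind by blast
      moreover have "card (leaves k H - R) = card (leaves k H) - card (leaves k H \<inter> R)"
        using fin by (simp add: card_Diff_subset_Int)
      \<comment> \<open>One of the two leaves of \<open>G\<close> is \<open>a\<close>, so a single
        old leaf avoids \<open>R\<close>. With at most one leaf inside \<open>R\<close> and at least
        two in \<open>H\<close>, both counts are determined.\<close>
      moreover have "card (leaves k H - R) = 1"
        using less.prems(3) False leavesG fin a by (auto simp: leaves_def)
      ultimately have "card (leaves k H) = 2" "card (leaves k H \<inter> R) = 1"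
        using ind by auto
      then show ?thesis by auto
    qed
    moreover have "card (pverts H) < card (pverts G)"
      using a pgH unfolding G by (simp add: pair_graph_iff)
    ultimately have "(forces H)\<^sup>*\<^sup>* R (pverts H)"
      using less.hyps[of H R] H R \<open>k \<ge> 1\<close> by blast
    then have "(forces G)\<^sup>*\<^sup>* (insert a R) (insert a (pverts H))"
      unfolding G using pgH a by (rule forces_attach_rtranclp)
    with step have "(forces G)\<^sup>*\<^sup>* Q (insert a (pverts H))"
      by (rule converse_rtranclp_into_rtranclp)
    then show ?thesis
      by (simp add: G)
  qed
qed

lemma linear_k_tree_zero_forcing_set:
  assumes "k \<ge> 1" "linear_k_tree k G"
  obtains Q where "zero_forcing_set G Q" "card Q = k"
proof -
  have G: "k_tree k G" using assms by (simp add: linear_k_tree_def)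
  have pg: "pair_graph G" using G by (rule k_tree_pair_graph)
  have lin: "card (pverts G) = k + 1 \<or> card (leaves k G) = 2"
    using assms(2) pg
    by (auto simp: linear_k_tree_def complete_iff_clique leaves_def out_degree_eq_card_nbrs)
  have "\<exists>Q a. is_clique G Q \<and> card Q = k \<and> a \<in> Q \<and> a \<in> leaves k G"
  proof (cases "card (pverts G) = k + 1")
    case True
    then have cl: "is_clique G (pverts G)" using k_tree_complete G by blast
    obtain Q where Q: "Q \<subseteq> pverts G" "card Q = k"
      using True by (metis le_add1 obtain_subset_with_card_n)
    moreover have "is_clique G Q"
      using cl Q by (auto simp: is_clique_def)
    moreover have "Q \<noteq> {}" using Q assms by auto
    ultimately show ?thesis
      using leaves_complete[OF pg cl True] by blast
  next
    case False
    then obtain a where "a \<in> leaves k G" using lin by fastforce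
    from k_tree_remove_leaf[OF G False this]
    obtain H R where H: "k_tree k H" "is_clique H R" "card R = k" "a \<notin> pverts H" "G = attach a R H"
      by blast
    \<comment> \<open>Exchanging one neighbour \<open>y\<close> of \<open>a\<close> for
      \<open>a\<close> itself turns \<open>R\<close> into a \<open>k\<close>-clique of
      \<open>G\<close> through the leaf \<open>a\<close>.\<close>
    obtain y where y: "y \<in> R" using H(3) assms by fastforce
    have "finite R" using H(3) assms by (simp add: card_ge_0_finite)
    moreover have "a \<notin> R" using H by (auto simp: is_clique_def)
    ultimately have "card (insert a (R - {y})) = k"
      using y H(3) assms by simp
    moreover have "is_clique G (insert a (R - {y}))"
      using H by (auto simp: is_clique_def)
    ultimately show ?thesis using \<open>a \<in> leaves k G\<close> by blast
  qed
  then obtain Q a where Q: "is_clique G Q" "card Q = k" "a \<in> Q" "a \<in> leaves k G" by blast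
  then have "zero_forcing_set G Q"
    using leaf_clique_forces[OF assms(1) G lin] by (auto simp: zero_forcing_set_def is_clique_def)
  with Q that show thesis by blast
qed

section \<open>A matrix of nullity at least \<open>k\<close>\<close>

text \<open>The cover consists of the initial clique and of each new vertex together with the clique
  it was joined to: one clique for the first \<open>k + 1\<close> vertices and at most one for each
  further vertex.\<close>

lemma k_tree_edge_clique_cover:
  assumes "k_tree k G"
  obtains \<C> where "finite \<C>" "card \<C> + k \<le> card (pverts G)"
    "\<forall>x y. x \<noteq> y \<longrightarrow> ((x, y) \<in> parcs G \<longleftrightarrow> (\<exists>C\<in>\<C>. x \<in> C \<and> y \<in> C))"
proof -
  have "\<exists>\<C>. finite \<C> \<and> \<Union>\<C> \<subseteq> pverts G \<and> card \<C> + k \<le> card (pverts G) \<and>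
    (\<forall>x y. x \<noteq> y \<longrightarrow> ((x, y) \<in> parcs G \<longleftrightarrow> (\<exists>C\<in>\<C>. x \<in> C \<and> y \<in> C)))"
    using assms
  proof (induction rule: k_tree_attach_induct)
    case (complete G)
    then show ?case
      by (intro exI[of _ "{pverts G}"]) (auto simp: is_clique_def pair_graph_iff)
  next
    case (attach G Q v)
    then obtain \<C> where C: "finite \<C>" "\<Union>\<C> \<subseteq> pverts G" "card \<C> + k \<le> card (pverts G)"
      "\<And>x y. x \<noteq> y \<Longrightarrow> (x, y) \<in> parcs G \<longleftrightarrow> (\<exists>C\<in>\<C>. x \<in> C \<and> y \<in> C)" by blast
    have Q: "Q \<subseteq> pverts G" "\<And>x y. \<lbrakk>x \<in> Q; y \<in> Q; x \<noteq> y\<rbrakk> \<Longrightarrow> (x, y) \<in> parcs G"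
      using attach(3) by (auto simp: is_clique_def)
    have "card (insert (insert v Q) \<C>) \<le> Suc (card \<C>)"
      using C(1) by (simp add: card_insert_if)
    then have "card (insert (insert v Q) \<C>) + k \<le> card (pverts (attach v Q G))"
      using C(3) attach(2,6) by (simp add: pair_graph_iff)
    moreover have "(x, y) \<in> parcs (attach v Q G) \<longleftrightarrow> (\<exists>C\<in>insert (insert v Q) \<C>. x \<in> C \<and> y \<in> C)"
      if "x \<noteq> y" for x y
      using C(4)[OF that] Q(2)[of x y] that by auto
    ultimately show ?case
      using C(1,2) Q(1) by (intro exI[of _ "insert (insert v Q) \<C>"]) auto
  qed
  with that show thesis by blast
qed

lemma k_tree_nullity_ge:
  assumes "k_tree k G"
  shows "\<exists>A\<in>graph_matrices G. k \<le> kernel_dim A"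
proof -
  have pg: "pair_graph G" using assms by (rule k_tree_pair_graph)
  obtain \<C> where C: "finite \<C>" "card \<C> + k \<le> card (pverts G)"
    "\<forall>x y. x \<noteq> y \<longrightarrow> ((x, y) \<in> parcs G \<longleftrightarrow> (\<exists>C\<in>\<C>. x \<in> C \<and> y \<in> C))"
    by (rule k_tree_edge_clique_cover[OF assms])
  let ?n = "card (pverts G)" and ?m = "card \<C>"
  obtain f where f: "bij_betw f {..<?n} (pverts G)"
    using pg by (metis ex_bij_betw_nat_finite atLeast0LessThan pair_graph_iff)
  obtain g where g: "bij_betw g {..<?m} \<C>"
    using C(1) by (metis ex_bij_betw_nat_finite atLeast0LessThan)
  define N where "N = mat ?m ?n (\<lambda>(l, i). if f i \<in> g l then 1 else 0 :: real)"
  have N: "N \<in> carrier_mat ?m ?n" by (simp add: N_def)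
  define A where "A = N\<^sup>T * N"
  \<comment> \<open>The entry counts the cliques containing both vertices; its summands are
    nonnegative, so nothing can cancel.\<close>
  have entry: "A $$ (i, j) = (\<Sum>l\<in>{0..<?m}. (if f i \<in> g l \<and> f j \<in> g l then 1 else 0))"
    if "i < ?n" "j < ?n" for i j
    using that by (auto simp: A_def N_def scalar_prod_def intro!: sum.cong)
  have "A $$ (i, j) \<noteq> 0 \<longleftrightarrow> (f i, f j) \<in> parcs G" if "i < ?n" "j < ?n" "i \<noteq> j" for i j
  proof -
    have "f i \<noteq> f j"
      using f that by (auto simp: bij_betw_def inj_on_def)
    then have "(f i, f j) \<in> parcs G \<longleftrightarrow> (\<exists>C\<in>g ` {..<?m}. f i \<in> C \<and> f j \<in> C)"
      using C(3) g by (simp add: bij_betw_def)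
    also have "\<dots> \<longleftrightarrow> A $$ (i, j) \<noteq> 0"
      unfolding entry[OF that(1,2)] by (subst sum_nonneg_eq_0_iff) auto
    finally show ?thesis by simp
  qed
  moreover have "A\<^sup>T = A"
    using N by (simp add: A_def transpose_mult[of _ ?n ?m _ ?n])
  moreover have "A \<in> carrier_mat ?n ?n"
    using N by (simp add: A_def)
  ultimately have "A \<in> graph_matrices G"
    using f by (auto simp: graph_matrices_def)
  moreover have "k \<le> kernel_dim A"
    using kernel_dim_transpose_mult_ge[OF N] C(2) by (simp add: A_def)
  ultimately show ?thesis by blast
qed

section \<open>Clique minors of \<open>k\<close>-trees\<close>

text \<open>Connectivity is expressed by cuts, so that merging branch sets and deleting a simplicial
  vertex need no manipulation of paths.\<close>

definition connected_in :: "'a pair_pre_digraph \<Rightarrow> 'a set \<Rightarrow> bool" where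
  "connected_in G B \<longleftrightarrow> B \<noteq> {} \<and>
     (\<forall>S. S \<subseteq> B \<and> S \<noteq> {} \<and> S \<noteq> B \<longrightarrow> (\<exists>x\<in>S. \<exists>y\<in>B - S. (x, y) \<in> parcs G))"

text \<open>The usual model of a minor: \<open>\<beta> x\<close> collects the vertices contracted
  into \<open>x\<close>. Edges between branch sets need not be edges of \<open>H\<close>, since a
  minor may drop edges.\<close>

definition branch_sets :: "'a pair_pre_digraph \<Rightarrow> 'a pair_pre_digraph \<Rightarrow> ('a \<Rightarrow> 'a set) \<Rightarrow> bool" where
  "branch_sets G H \<beta> \<longleftrightarrow>
     (\<forall>x\<in>pverts H. \<beta> x \<subseteq> pverts G \<and> connected_in G (\<beta> x)) \<and>
     (\<forall>x\<in>pverts H. \<forall>y\<in>pverts H. x \<noteq> y \<longrightarrow> \<beta> x \<inter> \<beta> y = {}) \<and>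
     (\<forall>x y. (x, y) \<in> parcs H \<longrightarrow> (\<exists>a\<in>\<beta> x. \<exists>b\<in>\<beta> y. (a, b) \<in> parcs G))"

text \<open>A set \<open>S\<close> that cuts neither part contains one of them and misses the other,
  so the joining edge, taken in the right direction, leaves \<open>S\<close>.\<close>

lemma connected_in_Un:
  assumes G: "pair_graph G" and B: "connected_in G B" "connected_in G C"
    and e: "a \<in> B" "b \<in> C" "(a, b) \<in> parcs G"
  shows "connected_in G (B \<union> C)"
  unfolding connected_in_def
proof (intro conjI allI impI)
  show "B \<union> C \<noteq> {}" using e by blast
  fix S assume S: "S \<subseteq> B \<union> C \<and> S \<noteq> {} \<and> S \<noteq> B \<union> C"
  have ba: "(b, a) \<in> parcs G"
    using G e by (auto simp: pair_graph_iff dest: symD)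
  consider "S \<inter> B \<noteq> {}" "S \<inter> B \<noteq> B" | "S \<inter> C \<noteq> {}" "S \<inter> C \<noteq> C"
    | "a \<in> S" "b \<notin> S" | "b \<in> S" "a \<notin> S"
    using S e by blast
  then show "\<exists>x\<in>S. \<exists>y\<in>B \<union> C - S. (x, y) \<in> parcs G"
  proof cases
    case 1
    then obtain x y where "x \<in> S \<inter> B" "y \<in> B - S \<inter> B" "(x, y) \<in> parcs G"
      using B(1) unfolding connected_in_def by (metis inf_le2)
    then show ?thesis by blast
  next
    case 2
    then obtain x y where "x \<in> S \<inter> C" "y \<in> C - S \<inter> C" "(x, y) \<in> parcs G"
      using B(2) unfolding connected_in_def by (metis inf_le2)
    then show ?thesis by blast
  qed (use e ba in blast)+
qed

text \<open>Deletions keep the branch sets; a contraction unites two of them, which stay connected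
  through an edge between them.\<close>

lemma graph_minor_branch_sets:
  assumes "graph_minor G H" "pair_graph G"
  shows "\<exists>\<beta>. branch_sets G H \<beta>"
  using assms
proof (induction rule: graph_minor.induct)
  case refl
  then show ?case
    by (intro exI[of _ "\<lambda>x. {x}"]) (auto simp: branch_sets_def connected_in_def)
next
  case (delete_edge H u v)
  then obtain \<beta> where "branch_sets G H \<beta>" by blast
  then have "branch_sets G (delete_edge H u v) \<beta>"
    by (simp add: branch_sets_def delete_edge_def)
  then show ?case by blast
next
  case (delete_vertex H v)
  then obtain \<beta> where "branch_sets G H \<beta>" by blast
  then have "branch_sets G (delete_vertex H v) \<beta>"
    by (simp add: branch_sets_def delete_vertex_def)
  then show ?case by blast
next
  case (contract_edge H u v)
  then obtain \<beta> where \<beta>: "branch_sets G H \<beta>" by blast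
  have H: "pair_graph H"
    using graph_minor_pair_graph contract_edge by blast
  then have uv: "u \<in> pverts H" "v \<in> pverts H" "u \<noteq> v"
    using contract_edge.hyps(2) by (auto simp: pair_graph_iff)
  obtain a b where ab: "a \<in> \<beta> u" "b \<in> \<beta> v" "(a, b) \<in> parcs G"
    using \<beta> contract_edge.hyps(2) unfolding branch_sets_def by blast
  define \<gamma> where "\<gamma> = \<beta>(u := \<beta> u \<union> \<beta> v)"
  have "connected_in G (\<beta> u \<union> \<beta> v)"
    using connected_in_Un[OF contract_edge.prems _ _ ab] \<beta> uv by (simp add: branch_sets_def)
  then have "\<forall>x\<in>pverts H - {v}. \<gamma> x \<subseteq> pverts G \<and> connected_in G (\<gamma> x)"
    using \<beta> uv by (simp add: branch_sets_def \<gamma>_def)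
  moreover have "\<forall>x\<in>pverts H - {v}. \<forall>y\<in>pverts H - {v}. x \<noteq> y \<longrightarrow> \<gamma> x \<inter> \<gamma> y = {}"
  proof (intro ballI impI)
    fix x y assume xy: "x \<in> pverts H - {v}" "y \<in> pverts H - {v}" "x \<noteq> y"
    have disj: "\<beta> x' \<inter> \<beta> y' = {}" if "x' \<in> pverts H" "y' \<in> pverts H" "x' \<noteq> y'" for x' y'
      using \<beta> that by (simp add: branch_sets_def)
    show "\<gamma> x \<inter> \<gamma> y = {}"
      using xy uv disj[of x y] disj[of v y] disj[of x v] by (auto simp: \<gamma>_def)
  qed
  \<comment> \<open>Each old branch set lies in that of the renamed vertex, so the edges of
    \<open>G\<close> witnessing old arcs also witness the contracted ones.\<close>
  moreover have "\<beta> x \<subseteq> \<gamma> (if x = v then u else x)" for x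
    by (simp add: \<gamma>_def)
  then have "\<exists>a\<in>\<gamma> (if x = v then u else x). \<exists>b\<in>\<gamma> (if y = v then u else y). (a, b) \<in> parcs G"
    if "(x, y) \<in> parcs H" for x y
    using \<beta> that unfolding branch_sets_def by (meson subsetD)
  then have "\<forall>x y. (x, y) \<in> parcs (contract_edge H u v) \<longrightarrow> (\<exists>a\<in>\<gamma> x. \<exists>b\<in>\<gamma> y. (a, b) \<in> parcs G)"
    unfolding contract_edge_def Let_def by fastforce
  ultimately have "branch_sets G (contract_edge H u v) \<gamma>"
    unfolding branch_sets_def by (simp add: contract_edge_def Let_def)
  then show ?case by blast
qed

text \<open>Choosing a point of \<open>S\<close> in each set is injective by disjointness.\<close>

lemma card_le_of_disjoint_meets:
  assumes "finite S" "\<And>i. i \<in> I \<Longrightarrow> \<beta> i \<inter> S \<noteq> {}"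
    and "\<And>i j. \<lbrakk>i \<in> I; j \<in> I; i \<noteq> j\<rbrakk> \<Longrightarrow> \<beta> i \<inter> \<beta> j = {}"
  shows "card I \<le> card S"
proof -
  obtain r where r: "\<forall>i\<in>I. r i \<in> \<beta> i \<inter> S"
    using bchoice[of I "\<lambda>i a. a \<in> \<beta> i \<inter> S"] assms(2) by blast
  have "inj_on r I"
  proof (rule inj_onI, rule ccontr)
    fix i j assume "i \<in> I" "j \<in> I" "r i = r j" "i \<noteq> j"
    then show False
      using r assms(3)[of i j] by auto
  qed
  moreover have "r ` I \<subseteq> S" using r by blast
  ultimately show ?thesis
    using assms(1) card_inj_on_le by blast
qed

text \<open>Any path through \<open>v\<close> runs between two vertices of \<open>Q\<close>, and
  these are adjacent already.\<close>

lemma connected_in_attach_remove: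
  assumes G: "pair_graph G" and Q: "is_clique G Q" and v: "v \<notin> pverts G"
    and B: "connected_in (attach v Q G) B" "B \<noteq> {v}"
  shows "connected_in G (B - {v})"
  unfolding connected_in_def
proof (intro conjI allI impI)
  show "B - {v} \<noteq> {}" using B by (auto simp: connected_in_def)
  fix S assume S: "S \<subseteq> B - {v} \<and> S \<noteq> {} \<and> S \<noteq> B - {v}"
  let ?T = "B - {v} - S"
  have T: "?T \<noteq> {}" using S by blast
  have cut: "\<exists>x\<in>S'. \<exists>y\<in>B - S'. (x, y) \<in> parcs (attach v Q G)"
    if "S' \<subseteq> B" "S' \<noteq> {}" "S' \<noteq> B" for S'
    using B(1) that unfolding connected_in_def by blast
  show "\<exists>x\<in>S. \<exists>y\<in>?T. (x, y) \<in> parcs G"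
  proof (cases "v \<in> B")
    case False
    then show ?thesis using cut[of S] S by auto
  next
    case True
    \<comment> \<open>The cuts \<open>S\<close> and \<open>insert v S\<close> are both crossed. If
      neither crossing arc lies in \<open>G\<close>, the first enters \<open>v\<close> and the
      second leaves it, so their other ends are vertices of \<open>Q\<close> on opposite
      sides.\<close>
    obtain x y where xy: "x \<in> S" "y \<in> B - S" "(x, y) \<in> parcs (attach v Q G)"
      using cut[of S] S True by blast
    obtain z w where zw: "z \<in> insert v S" "w \<in> ?T" "(z, w) \<in> parcs (attach v Q G)"
      using cut[of "insert v S"] S T True by blast
    consider "y \<noteq> v" | "z \<noteq> v" | "y = v" "z = v" by blast
    then show ?thesis
    proof cases
      case 1
      then have "(x, y) \<in> parcs G" using xy S by auto
      with 1 xy show ?thesis by blast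
    next
      case 2
      then have "(z, w) \<in> parcs G" using zw by auto
      with 2 zw show ?thesis by blast
    next
      case 3
      then have "x \<in> Q" "w \<in> Q"
        using xy zw S G v by (auto simp: pair_graph_iff)
      then have "(x, w) \<in> parcs G"
        using Q xy zw by (auto simp: is_clique_def)
      with xy zw show ?thesis by blast
    qed
  qed
qed

text \<open>The family is indexed by a fixed \<open>I\<close> so that its members may shrink while
  its size stays: unless \<open>{v}\<close> itself is a branch set, \<open>v\<close> is removed from
  all of them.\<close>

lemma k_tree_clique_minor_le:
  assumes "k_tree k G" "finite I"
    "\<And>i. i \<in> I \<Longrightarrow> \<beta> i \<subseteq> pverts G \<and> connected_in G (\<beta> i)"
    "\<And>i j. \<lbrakk>i \<in> I; j \<in> I; i \<noteq> j\<rbrakk> \<Longrightarrow> \<beta> i \<inter> \<beta> j = {} \<and> (\<exists>a\<in>\<beta> i. \<exists>b\<in>\<beta> j. (a, b) \<in> parcs G)"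
  shows "card I \<le> k + 1"
  using assms
proof (induction arbitrary: \<beta> rule: k_tree_attach_induct)
  case (complete G)
  have "card I \<le> card (pverts G)"
  proof (rule card_le_of_disjoint_meets)
    show "finite (pverts G)" using complete(1) by (simp add: pair_graph_iff)
    show "\<beta> i \<inter> pverts G \<noteq> {}" if "i \<in> I" for i
      using complete.prems(2)[OF that] unfolding connected_in_def by blast
  qed (use complete.prems(3) in blast)
  then show ?case using complete by simp
next
  case (attach G Q v)
  have Q: "Q \<subseteq> pverts G" using attach(3) by (simp add: is_clique_def)
  show ?case
  proof (cases "\<exists>i\<in>I. \<beta> i = {v}")
    case True
    then obtain i where i: "i \<in> I" "\<beta> i = {v}" by blast
    \<comment> \<open>Every other branch set is adjacent to \<open>{v}\<close> and hence contains
      one of the \<open>k\<close> vertices of \<open>Q\<close>.\<close>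
    have "card (I - {i}) \<le> card Q"
    proof (rule card_le_of_disjoint_meets[of _ _ \<beta>])
      fix j assume "j \<in> I - {i}"
      then obtain b where "b \<in> \<beta> j" "(v, b) \<in> parcs (attach v Q G)"
        using attach.prems(3)[of i j] i by auto
      then show "\<beta> j \<inter> Q \<noteq> {}"
        using attach(2,6) Q by (auto simp: pair_graph_iff)
    qed (use attach in auto)
    then show ?thesis
      using i attach.prems(1) attach(5) by simp
  next
    case False
    show ?thesis
    proof (rule attach.IH)
      fix i assume "i \<in> I"
      then show "\<beta> i - {v} \<subseteq> pverts G \<and> connected_in G (\<beta> i - {v})"
        using False attach.prems(2)[of i] connected_in_attach_remove[OF attach(2,3,6), of "\<beta> i"] by auto
    next
      fix i j assume ij: "i \<in> I" "j \<in> I" "i \<noteq> j"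
      \<comment> \<open>The cut \<open>{v}\<close> of a larger branch set is crossed by an arc, and
        all neighbours of \<open>v\<close> lie in \<open>Q\<close>.\<close>
      have meet: "\<exists>q\<in>\<beta> l. q \<in> Q" if "l \<in> I" "v \<in> \<beta> l" for l
      proof -
        have "\<beta> l \<noteq> {v}" "connected_in (attach v Q G) (\<beta> l)"
          using False that attach.prems(2) by auto
        then have "\<exists>x\<in>{v}. \<exists>y\<in>\<beta> l - {v}. (x, y) \<in> parcs (attach v Q G)"
          using that unfolding connected_in_def by (metis empty_not_insert empty_subsetI insert_subset)
        then show ?thesis
          using attach(2,6) by (auto simp: pair_graph_iff)
      qed
      obtain a b where ab: "a \<in> \<beta> i" "b \<in> \<beta> j" "(a, b) \<in> parcs (attach v Q G)"
        and disj: "\<beta> i \<inter> \<beta> j = {}"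
        using attach.prems(3)[OF ij] by blast
      have "\<exists>a'\<in>\<beta> i - {v}. \<exists>b'\<in>\<beta> j - {v}. (a', b') \<in> parcs G"
      proof (cases "a = v \<or> b = v")
        case False
        then show ?thesis using ab by auto
      next
        case True
        \<comment> \<open>The branch set containing \<open>v\<close> meets \<open>Q\<close> by
          \<open>meet\<close>, the other one in its end of the joining edge; the two points found
          are distinct and adjacent in \<open>G\<close>.\<close>
        have "\<exists>a'\<in>\<beta> i. a' \<in> Q" "\<exists>b'\<in>\<beta> j. b' \<in> Q"
          using True ab meet ij attach(2,6) by (auto simp: pair_graph_iff)
        then obtain a' b' where "a' \<in> \<beta> i" "a' \<in> Q" "b' \<in> \<beta> j" "b' \<in> Q" by blast
        moreover have "a' \<noteq> b'" "a' \<noteq> v" "b' \<noteq> v"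
          using calculation disj Q attach(6) by auto
        ultimately show ?thesis
          using attach(3) unfolding is_clique_def by blast
      qed
      with disj show "(\<beta> i - {v}) \<inter> (\<beta> j - {v}) = {} \<and>
        (\<exists>a\<in>\<beta> i - {v}. \<exists>b\<in>\<beta> j - {v}. (a, b) \<in> parcs G)" by blast
    qed (use attach.prems in simp)
  qed
qed

section \<open>The value of the Hadwiger number\<close>

lemma graph_minor_trans:
  assumes "graph_minor H J" "graph_minor G H"
  shows "graph_minor G J"
  using assms by (induction rule: graph_minor.induct) (auto intro: graph_minor.intros)

lemma delete_vertex_attach:
  assumes "pair_graph G" "v \<notin> pverts G"
  shows "delete_vertex (attach v Q G) v = G"
  using assms by (cases G) (auto simp: delete_vertex_def attach_def pair_graph_iff)

text \<open>Deleting the attached vertices in reverse order leads back to the initial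
  clique.\<close>

lemma k_tree_complete_minor:
  assumes "k_tree k G"
  shows "\<exists>H. graph_minor G H \<and> K\<^bsub>k + 1\<^esub> (with_proj H)"
  using assms
proof (induction rule: k_tree_attach_induct)
  case (complete G)
  then show ?case
    using complete_iff_clique graph_minor.refl by blast
next
  case (attach G Q v)
  have "graph_minor (attach v Q G) (delete_vertex (attach v Q G) v)"
    by (intro graph_minor.delete_vertex graph_minor.refl) simp
  then have "graph_minor (attach v Q G) G"
    using delete_vertex_attach attach(2,6) by metis
  with attach.IH show ?case
    using graph_minor_trans by blast
qed

lemma k_tree_hadwiger_number:
  assumes "k_tree k G"
  shows "hadwiger_number G = k + 1"
  unfolding hadwiger_number_def
proof (rule Max_eqI)
  have pg: "pair_graph G" using assms by (rule k_tree_pair_graph)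
  show "finite {t. \<exists>H. graph_minor G H \<and> K\<^bsub>t\<^esub> (with_proj H)}"
    by (rule hadwiger_wf[OF pg])
  show "k + 1 \<in> {t. \<exists>H. graph_minor G H \<and> K\<^bsub>t\<^esub> (with_proj H)}"
    using k_tree_complete_minor[OF assms] by simp
  fix t assume "t \<in> {t. \<exists>H. graph_minor G H \<and> K\<^bsub>t\<^esub> (with_proj H)}"
  then obtain H where H: "graph_minor G H" "K\<^bsub>t\<^esub> (with_proj H)" by blast
  obtain \<beta> where \<beta>: "branch_sets G H \<beta>"
    using graph_minor_branch_sets[OF H(1) pg] by blast
  have "card (pverts H) \<le> k + 1"
  proof (rule k_tree_clique_minor_le[OF assms])
    show "finite (pverts H)" using H(2) by (simp add: complete_digraph_pair_def)
  next
    fix i j assume "i \<in> pverts H" "j \<in> pverts H" "i \<noteq> j"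
    moreover from this have "(i, j) \<in> parcs H"
      using H(2) by (simp add: complete_digraph_pair_def)
    ultimately show "\<beta> i \<inter> \<beta> j = {} \<and> (\<exists>a\<in>\<beta> i. \<exists>b\<in>\<beta> j. (a, b) \<in> parcs G)"
      using \<beta> by (simp add: branch_sets_def)
  qed (use \<beta> in \<open>simp add: branch_sets_def\<close>)
  then show "t \<le> k + 1" using H(2) by (simp add: complete_digraph_pair_def)
qed

theorem theorem4p25:
  fixes G :: "'a pair_pre_digraph" and k :: nat
  assumes "k \<ge> 1" and "linear_k_tree k G"
  shows "hadwiger_number G - 1 = max_nullity G \<and>
    max_nullity G = zero_forcing_number G \<and> zero_forcing_number G = k"
proof -
  have G: "k_tree k G" using assms by (simp add: linear_k_tree_def)
  have pg: "pair_graph G" using G by (rule k_tree_pair_graph)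
  have finM: "finite (kernel_dim ` graph_matrices G)"
    using max_nullity_wf[OF pg] by simp
  have finZ: "finite (card ` {B. zero_forcing_set G B})"
    using zero_forcing_wf[OF pg] by simp
  obtain A where A: "A \<in> graph_matrices G" "k \<le> kernel_dim A"
    using k_tree_nullity_ge[OF G] by blast
  obtain Q where Q: "zero_forcing_set G Q" "card Q = k"
    using linear_k_tree_zero_forcing_set[OF assms] .
  have le: "kernel_dim A' \<le> card B" if "A' \<in> graph_matrices G" "zero_forcing_set G B" for A' B
    using nullity_le_zero_forcing[OF pg that] .
  \<comment> \<open>\<open>A\<close> and \<open>Q\<close> pinch the bound:
    \<open>k \<le> kernel_dim A \<le> card Q = k\<close>. Comparing every matrix with
    \<open>Q\<close> and every zero forcing set with \<open>A\<close> then shows that both are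
    extremal.\<close>
  have "kernel_dim A = k"
    using A le[OF A(1) Q(1)] Q(2) by simp
  then have "max_nullity G = k"
    unfolding max_nullity_def using A(1) Q le by (intro Max_eqI[OF finM]) force+
  moreover have "zero_forcing_number G = k"
    unfolding zero_forcing_number_def using A Q le by (intro Min_eqI[OF finZ]) force+
  ultimately show ?thesis
    by (simp add: k_tree_hadwiger_number[OF G])
qed

end
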